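(* Let $S=\{0,u,1\}$ be a multiplicatively idempotent semiring with three elements such that $u+u\neq 1$. Then $S$ is local and Artinian but not completely primary.
   Context: A semiring is an algebraic structure $(S,+,\cdot,0,1)$ such that $(S,+,0)$ and $(S,\cdot,1)$ are commutative monoids, multiplication distributes over addition, and $s\cdot 0=0$ for all $s\in S$. It is multiplicatively idempotent if $s^2=s$ for all $s\in S$. A nonempty subset $I\subseteq S$ is an ideal if $a+b\in I$ and $sa\in I$ for all $a,b\in I$ and $s\in S$; a maximal ideal is an ideal maximal among the ideals different from $S$. A semiring is local if it has exactly one maximal ideal, and Artinian if it satisfies the descending chain condition on ideals. An element $s\in S$ is a unit if $st=1$ for some $t\in S$; it is nilpotent if $s^n=0$ for some positive integer $n$. A semiring is completely primary if each of its elements is either a unit or nilpotent. *)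

theory Defs
  imports "HOL-Algebra.Ring"
begin

text \<open>
  A semiring here is commutative and unital, and the case \<open>\<zero> = \<one>\<close> is allowed.
  The locale \<^locale>\<open>semiring\<close> leaves multiplication possibly non-commutative.
\<close>

locale csemiring = semiring S + comm_monoid S for S (structure)

definition mult_idempotent :: "('a, 'b) ring_scheme \<Rightarrow> bool" where
  "mult_idempotent S \<longleftrightarrow> (\<forall>s\<in>carrier S. s \<otimes>\<^bsub>S\<^esub> s = s)"

text \<open>
  The predicate \<open>ideal\<close> of HOL-Algebra requires a ring and an additive subgroup, so it
  does not apply to semirings.
\<close>

definition semiring_ideal :: "('a, 'b) ring_scheme \<Rightarrow> 'a set \<Rightarrow> bool" where
  "semiring_ideal S I \<longleftrightarrow>
     I \<subseteq> carrier S \<and> I \<noteq> {} \<and>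
     (\<forall>a\<in>I. \<forall>b\<in>I. a \<oplus>\<^bsub>S\<^esub> b \<in> I) \<and>
     (\<forall>s\<in>carrier S. \<forall>a\<in>I. s \<otimes>\<^bsub>S\<^esub> a \<in> I)"

definition maximal_semiring_ideal :: "('a, 'b) ring_scheme \<Rightarrow> 'a set \<Rightarrow> bool" where
  "maximal_semiring_ideal S M \<longleftrightarrow>
     semiring_ideal S M \<and> M \<noteq> carrier S \<and>
     (\<forall>J. semiring_ideal S J \<and> J \<noteq> carrier S \<and> M \<subseteq> J \<longrightarrow> J = M)"

definition local_semiring :: "('a, 'b) ring_scheme \<Rightarrow> bool" where
  "local_semiring S \<longleftrightarrow> (\<exists>!M. maximal_semiring_ideal S M)"

definition artinian_semiring :: "('a, 'b) ring_scheme \<Rightarrow> bool" where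
  "artinian_semiring S \<longleftrightarrow>
     (\<forall>I :: nat \<Rightarrow> 'a set.
        (\<forall>n. semiring_ideal S (I n)) \<and> (\<forall>n. I (Suc n) \<subseteq> I n) \<longrightarrow>
        (\<exists>N. \<forall>n\<ge>N. I n = I N))"

definition nilpotent_element :: "('a, 'b) ring_scheme \<Rightarrow> 'a \<Rightarrow> bool" where
  "nilpotent_element S s \<longleftrightarrow> (\<exists>n::nat. n > 0 \<and> s [^]\<^bsub>S\<^esub> n = \<zero>\<^bsub>S\<^esub>)"

definition completely_primary :: "('a, 'b) ring_scheme \<Rightarrow> bool" where
  "completely_primary S \<longleftrightarrow> (\<forall>s\<in>carrier S. s \<in> Units S \<or> nilpotent_element S s)"

end

theory Submission imports Defs
begin

text \<open>
  A proper ideal cannot contain \<open>\<one>\<close>, so every proper ideal of \<open>{\<zero>, u, \<one>}\<close> lies in \<open>{\<zero>, u}\<close>.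
  This set is closed under multiplication by arbitrary elements because \<open>u \<otimes> u = u\<close>, and
  closed under addition exactly because \<open>u \<oplus> u \<noteq> \<one>\<close>. Hence it is the largest proper ideal, and
  the semiring is local. The chain condition is automatic for a finite carrier.

  Multiplicative idempotence makes \<open>u\<close> an obstruction to being completely primary: an idempotent
  that is a unit equals \<open>\<one>\<close> (cancel one factor in \<open>x \<otimes> x = x\<close>), and an idempotent that is
  nilpotent equals \<open>\<zero>\<close> (its positive powers are all equal to itself). So a completely primary
  multiplicatively idempotent semiring has only the elements \<open>\<zero>\<close> and \<open>\<one>\<close>.
\<close>

lemma semiring_ideal_one_imp_carrier:
  fixes S (structure)
  assumes "csemiring S" and I: "semiring_ideal S I" and "\<one> \<in> I"
  shows "I = carrier S"
proof -
  interpret csemiring S by fact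
  have "s \<in> I" if "s \<in> carrier S" for s
  proof -
    have "s \<otimes> \<one> \<in> I"
      using I \<open>\<one> \<in> I\<close> that unfolding semiring_ideal_def by blast
    with that show ?thesis by simp
  qed
  with I show ?thesis unfolding semiring_ideal_def by blast
qed

lemma local_semiring_if_greatest_proper_ideal:
  assumes "semiring_ideal S M" and "M \<noteq> carrier S"
    and "\<And>J. semiring_ideal S J \<Longrightarrow> J \<noteq> carrier S \<Longrightarrow> J \<subseteq> M"
  shows "local_semiring S"
  unfolding local_semiring_def
proof (rule ex1I)
  show "maximal_semiring_ideal S M"
    using assms unfolding maximal_semiring_ideal_def by blast
next
  fix N
  assume "maximal_semiring_ideal S N"
  then show "N = M"
    using assms unfolding maximal_semiring_ideal_def by metis
qed

text \<open>
  In a descending chain of finite sets, a member of least cardinality equals all later ones.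
\<close>

lemma finite_imp_artinian_semiring:
  assumes "finite (carrier S)"
  shows "artinian_semiring S"
  unfolding artinian_semiring_def
proof (intro allI impI)
  fix I :: "nat \<Rightarrow> 'a set"
  assume "(\<forall>n. semiring_ideal S (I n)) \<and> (\<forall>n. I (Suc n) \<subseteq> I n)"
  then have ideal: "\<And>n. semiring_ideal S (I n)" and step: "\<And>n. I (Suc n) \<subseteq> I n"
    by auto
  have fin: "finite (I n)" for n
    using ideal[of n] assms finite_subset unfolding semiring_ideal_def by blast
  obtain N where least: "\<And>n. card (I N) \<le> card (I n)"
    using ex_has_least_nat[of "\<lambda>_. True" _ "\<lambda>n. card (I n)"] by blast
  have "I n = I N" if "n \<ge> N" for n
    using lift_Suc_antimono_le[of I, OF step that] card_seteq[OF fin _ least] by blast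
  then show "\<exists>N. \<forall>n\<ge>N. I n = I N" by blast
qed

lemma (in monoid) idempotent_unit_eq_one:
  assumes "x \<in> Units G" and "x \<otimes> x = x"
  shows "x = \<one>"
proof -
  have "x \<otimes> x = x \<otimes> \<one>" using assms Units_closed by simp
  with assms(1) show ?thesis by (metis Units_closed Units_l_cancel one_closed)
qed

lemma (in monoid) idempotent_nat_pow:
  fixes n :: nat
  assumes "x \<in> carrier G" and "x \<otimes> x = x" and "n > 0"
  shows "x [^] n = x"
  using assms(3)
proof (induction n rule: nat_induct_non_zero)
  case 1
  with assms(1) show ?case by simp
next
  case (Suc n)
  with assms(2) show ?case by simp
qed

lemma completely_primary_mult_idempotent_carrier:
  fixes S (structure)
  assumes "csemiring S" and "mult_idempotent S" and "completely_primary S"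
  shows "carrier S = {\<zero>, \<one>}"
proof -
  interpret csemiring S by fact
  have "s = \<zero> \<or> s = \<one>" if s: "s \<in> carrier S" for s
  proof -
    have idem: "s \<otimes> s = s"
      using assms(2) s unfolding mult_idempotent_def by blast
    have "s \<in> Units S \<or> nilpotent_element S s"
      using assms(3) s unfolding completely_primary_def by blast
    then show ?thesis
    proof
      assume "s \<in> Units S"
      then show ?thesis using idempotent_unit_eq_one idem by blast
    next
      assume "nilpotent_element S s"
      then show ?thesis
        using idempotent_nat_pow[OF s idem] unfolding nilpotent_element_def by auto
    qed
  qed
  then show ?thesis by auto
qed

theorem proposition4p8:
  fixes S :: "('a, 'b) ring_scheme" (structure) and u :: 'a
  assumes "csemiring S"
    and "mult_idempotent S"
    and "carrier S = {\<zero>, u, \<one>}"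
    and "card (carrier S) = 3"
    and "u \<oplus> u \<noteq> \<one>"
  shows "local_semiring S \<and> artinian_semiring S \<and> \<not> completely_primary S"
proof (intro conjI)
  interpret csemiring S by fact
  have u: "u \<in> carrier S" using assms(3) by simp
  have distinct: "u \<noteq> \<zero>" "u \<noteq> \<one>" "\<zero> \<noteq> \<one>"
    using assms(3,4) by (auto simp: card_insert_if split: if_splits)
  have "u \<oplus> u \<in> {\<zero>, u}"
    using a_closed[OF u u] assms(3,5) by auto
  moreover have "u \<otimes> u = u"
    using assms(2) u unfolding mult_idempotent_def by blast
  ultimately have ideal: "semiring_ideal S {\<zero>, u}"
    using u assms(3) unfolding semiring_ideal_def by auto
  show "local_semiring S"
  proof (rule local_semiring_if_greatest_proper_ideal[OF ideal])
    have "\<one> \<notin> {\<zero>, u}" using distinct by simp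
    then show "{\<zero>, u} \<noteq> carrier S" using one_closed by blast
  next
    fix J
    assume J: "semiring_ideal S J" "J \<noteq> carrier S"
    then have "\<one> \<notin> J" using semiring_ideal_one_imp_carrier[OF assms(1)] by blast
    with J(1) show "J \<subseteq> {\<zero>, u}"
      using assms(3) unfolding semiring_ideal_def by blast
  qed
  show "artinian_semiring S"
    using assms(3) by (intro finite_imp_artinian_semiring) simp
  show "\<not> completely_primary S"
    using completely_primary_mult_idempotent_carrier[OF assms(1,2)] u distinct by auto
qed

end
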